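(* Let $c$ and $d$ be positive integers with $c\ge 3$ and $d\ge 1$. Then there exists a connected, nontraceable detour graph with chromatic number $c$ and detour deficiency $d$.
   Context: All graphs are finite and simple; the order of a path is its number of vertices. For a vertex $v$, $\tau(v)$ is the order of a longest path in the graph having $v$ as an endvertex, and $\tau(G)$ is the order of a longest path in $G$. A detour graph is one in which all vertices have the same $\tau(v)$. Nontraceable means having no hamiltonian path. The detour deficiency of $G$ is $|V(G)|-\tau(G)$. *)

theory Defs
  imports Main
begin

definition simple_graph :: "'a set \<Rightarrow> ('a \<Rightarrow> 'a \<Rightarrow> bool) \<Rightarrow> bool" where
  "simple_graph V E \<longleftrightarrow> finite V \<and> (\<forall>u v. E u v \<longrightarrow> u \<in> V \<and> v \<in> V)
     \<and> (\<forall>u v. E u v \<longrightarrow> E v u) \<and> (\<forall>v. \<not> E v v)"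

definition is_path :: "'a set \<Rightarrow> ('a \<Rightarrow> 'a \<Rightarrow> bool) \<Rightarrow> 'a list \<Rightarrow> bool" where
  "is_path V E p \<longleftrightarrow> p \<noteq> [] \<and> distinct p \<and> set p \<subseteq> V
     \<and> (\<forall>i. Suc i < length p \<longrightarrow> E (p ! i) (p ! Suc i))"

definition tau_v :: "'a set \<Rightarrow> ('a \<Rightarrow> 'a \<Rightarrow> bool) \<Rightarrow> 'a \<Rightarrow> nat" where
  "tau_v V E v = Max {length p | p. is_path V E p \<and> (hd p = v \<or> last p = v)}"

definition tau :: "'a set \<Rightarrow> ('a \<Rightarrow> 'a \<Rightarrow> bool) \<Rightarrow> nat" where
  "tau V E = Max {length p | p. is_path V E p}"

definition detour_graph :: "'a set \<Rightarrow> ('a \<Rightarrow> 'a \<Rightarrow> bool) \<Rightarrow> bool" where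
  "detour_graph V E \<longleftrightarrow> (\<forall>u\<in>V. \<forall>v\<in>V. tau_v V E u = tau_v V E v)"

definition traceable :: "'a set \<Rightarrow> ('a \<Rightarrow> 'a \<Rightarrow> bool) \<Rightarrow> bool" where
  "traceable V E \<longleftrightarrow> (\<exists>p. is_path V E p \<and> set p = V)"

definition graph_connected :: "'a set \<Rightarrow> ('a \<Rightarrow> 'a \<Rightarrow> bool) \<Rightarrow> bool" where
  "graph_connected V E \<longleftrightarrow> (\<forall>u\<in>V. \<forall>v\<in>V. \<exists>p. is_path V E p \<and> hd p = u \<and> last p = v)"

definition proper_colouring :: "'a set \<Rightarrow> ('a \<Rightarrow> 'a \<Rightarrow> bool) \<Rightarrow> nat \<Rightarrow> ('a \<Rightarrow> nat) \<Rightarrow> bool" where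
  "proper_colouring V E k f \<longleftrightarrow> (\<forall>v\<in>V. f v < k) \<and> (\<forall>u v. E u v \<longrightarrow> f u \<noteq> f v)"

definition chromatic_number :: "'a set \<Rightarrow> ('a \<Rightarrow> 'a \<Rightarrow> bool) \<Rightarrow> nat" where
  "chromatic_number V E = (LEAST k. \<exists>f. proper_colouring V E k f)"

definition detour_deficiency :: "'a set \<Rightarrow> ('a \<Rightarrow> 'a \<Rightarrow> bool) \<Rightarrow> nat" where
  "detour_deficiency V E = card V - tau V E"

end

theory Submission
  imports Defs "HOL-Library.Countable"
begin

text \<open>Let \<open>n = d + 1\<close>. Take a cubic multigraph with \<open>2 * n\<close> nodes, subdivide each of its \<open>3 * n\<close>
  edges by a linker, and replace each node by a clique on \<open>c\<close> vertices, three of which receive the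
  three incident edges. A path uses an even number of the three boundary edges of a clique that
  contains none of its ends, hence at most two of them; double counting then shows that it contains
  at most \<open>2 * n + 1\<close> linkers, so it misses at least \<open>d\<close> vertices. If the multigraph is a ring whose
  edges are alternately doubled, then from every vertex there is a path that goes around the ring
  and misses exactly \<open>d\<close> of the doubling edges' linkers. Such paths cover more than half of the
  vertices, so any two of them meet, and the graph is connected.\<close>

section \<open>Paths\<close>

lemma is_path_iff_successively:
  "is_path V E p \<longleftrightarrow> p \<noteq> [] \<and> distinct p \<and> set p \<subseteq> V \<and> successively E p"
  by (auto simp: is_path_def successively_conv_nth)

lemma is_path_rev:
  assumes "is_path V E p" and "\<And>x y. E x y \<Longrightarrow> E y x"
  shows "is_path V E (rev p)"
proof -
  have "successively (\<lambda>x y. E y x) p"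
    using assms by (auto simp: is_path_iff_successively intro: successively_mono)
  then show ?thesis
    using assms(1) by (simp add: is_path_iff_successively successively_rev)
qed

lemma successively_rtranclp:
  assumes "successively E p" "x \<in> set p"
  shows "E\<^sup>*\<^sup>* (hd p) x"
  using assms
proof (induction p rule: induct_list012)
  case (3 a b r)
  then show ?case by (auto intro: converse_rtranclp_into_rtranclp)
qed auto

lemma rtranclp_imp_is_path:
  assumes "E\<^sup>*\<^sup>* u v" "u \<in> V" "\<And>x y. E x y \<Longrightarrow> x \<in> V \<and> y \<in> V"
  shows "\<exists>p. is_path V E p \<and> hd p = u \<and> last p = v"
  using assms
proof (induction rule: rtranclp_induct)
  case base
  then have "is_path V E [u]" by (simp add: is_path_iff_successively)
  then show ?case by fastforce
next
  case (step y z)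
  then obtain p where p: "is_path V E p" "hd p = u" "last p = y" by blast
  show ?case
  proof (cases "z \<in> set p")
    \<comment> \<open>If the new vertex already lies on the path, cutting the path off there keeps
      it simple.\<close>
    case True
    then obtain xs ys where "p = xs @ z # ys" by (meson split_list)
    with p have "is_path V E (xs @ [z])" "hd (xs @ [z]) = u"
      by (auto simp: is_path_iff_successively successively_append_iff hd_append)
    then show ?thesis by fastforce
  next
    case False
    have "is_path V E (p @ [z])" "hd (p @ [z]) = u"
      using False p step by (auto simp: is_path_iff_successively successively_append_iff)
    then show ?thesis by fastforce
  qed
qed

lemma is_path_length_card:
  assumes "is_path V E p"
  shows "length p = card (set p)"
  using assms by (simp add: is_path_iff_successively distinct_card)

text \<open>Two paths that each cover more than half of the vertices share a vertex
  \<open>x\<close>; by symmetry of \<open>E\<close>, reachability of \<open>x\<close> from both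
  starts links the starts.\<close>

lemma connected_if_long_paths:
  assumes "simple_graph V E" "card V < 2 * l"
    and "\<And>v. v \<in> V \<Longrightarrow> \<exists>p. is_path V E p \<and> hd p = v \<and> l \<le> length p"
  shows "graph_connected V E"
  unfolding graph_connected_def
proof (intro ballI)
  fix u v assume uv: "u \<in> V" "v \<in> V"
  obtain p where p: "is_path V E p" "hd p = u" "l \<le> length p" using assms(3) uv by blast
  obtain q where q: "is_path V E q" "hd q = v" "l \<le> length q" using assms(3) uv by blast
  have fin: "finite V" and sym: "symp E"
    using assms(1) by (auto simp: simple_graph_def symp_def)
  have "set p \<inter> set q \<noteq> {}"
  proof
    assume "set p \<inter> set q = {}"
    then have "length p + length q = card (set p \<union> set q)"
      using p q by (simp add: is_path_length_card card_Un_disjoint)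
    also have "\<dots> \<le> card V"
      using p q fin by (auto simp: is_path_iff_successively intro: card_mono)
    finally show False using p q assms(2) by linarith
  qed
  then obtain x where "x \<in> set p" "x \<in> set q" by blast
  then have "E\<^sup>*\<^sup>* u x" "E\<^sup>*\<^sup>* v x"
    using p q by (auto simp: is_path_iff_successively dest: successively_rtranclp)
  moreover have "symp E\<^sup>*\<^sup>*" using sym by (simp add: symp_rtranclp)
  ultimately have "E\<^sup>*\<^sup>* u v" by (meson rtranclp_trans sympD)
  then show "\<exists>p. is_path V E p \<and> hd p = u \<and> last p = v"
    using assms(1) uv by (intro rtranclp_imp_is_path) (auto simp: simple_graph_def)
qed

lemma tau_v_eqI:
  assumes "\<And>p. is_path V E p \<Longrightarrow> length p \<le> l"
    and "is_path V E p" "hd p = v" "length p = l"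
  shows "tau_v V E v = l"
  unfolding tau_v_def
proof (rule Max_eqI)
  show "finite {length p |p. is_path V E p \<and> (hd p = v \<or> last p = v)}"
    by (rule finite_subset[of _ "{..l}"]) (use assms in auto)
qed (use assms in auto)

lemma tau_eqI:
  assumes "\<And>p. is_path V E p \<Longrightarrow> length p \<le> l" and "is_path V E p" "length p = l"
  shows "tau V E = l"
  unfolding tau_def
proof (rule Max_eqI)
  show "finite {length p |p. is_path V E p}"
    by (rule finite_subset[of _ "{..l}"]) (use assms in auto)
qed (use assms in auto)

section \<open>Renaming vertices\<close>

text \<open>The construction lives on the datatype \<open>vertex\<close>, the theorem asks for
  natural numbers; the graph is carried over along an injection.\<close>

definition rename_adj :: "('a \<Rightarrow> 'b) \<Rightarrow> ('a \<Rightarrow> 'a \<Rightarrow> bool) \<Rightarrow> 'b \<Rightarrow> 'b \<Rightarrow> bool" where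
  "rename_adj f E u v \<longleftrightarrow> (\<exists>x y. u = f x \<and> v = f y \<and> E x y)"

lemma rename_adj_apply [simp]: "inj f \<Longrightarrow> rename_adj f E (f x) (f y) \<longleftrightarrow> E x y"
  by (auto simp: rename_adj_def inj_eq)

lemma simple_graph_rename:
  assumes "inj f" "simple_graph V E"
  shows "simple_graph (f ` V) (rename_adj f E)"
  using assms unfolding simple_graph_def rename_adj_def by (auto simp: inj_eq)

lemma is_path_rename_map:
  assumes "inj f"
  shows "is_path (f ` V) (rename_adj f E) (map f p) \<longleftrightarrow> is_path V E p"
  using assms
  by (simp add: is_path_iff_successively distinct_map successively_map inj_image_subset_iff
      inj_on_subset[of f UNIV])

lemma is_path_renameE:
  assumes "inj f" "is_path (f ` V) (rename_adj f E) p'"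
  obtains p where "is_path V E p" "p' = map f p"
proof -
  have "p' \<in> lists (f ` V)" using assms(2) by (auto simp: is_path_def)
  then obtain p where "p' = map f p" by (auto simp: lists_image)
  with assms that show thesis by (simp add: is_path_rename_map)
qed

text \<open>Colourings pull back along \<open>f\<close> and push forward along \<open>inv f\<close>,
  so both \<open>LEAST\<close>s range over the same numbers.\<close>

lemma chromatic_number_rename:
  assumes "inj f"
  shows "chromatic_number (f ` V) (rename_adj f E) = chromatic_number V E"
proof -
  have "(\<exists>g. proper_colouring (f ` V) (rename_adj f E) k g)
      \<longleftrightarrow> (\<exists>g. proper_colouring V E k g)" for k
  proof
    assume "\<exists>g. proper_colouring (f ` V) (rename_adj f E) k g"
    then obtain g where "proper_colouring (f ` V) (rename_adj f E) k g" by blast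
    then have "proper_colouring V E k (g \<circ> f)"
      unfolding proper_colouring_def rename_adj_def by (metis comp_apply imageI)
    then show "\<exists>g. proper_colouring V E k g" by blast
  next
    assume "\<exists>g. proper_colouring V E k g"
    then obtain g where "proper_colouring V E k g" by blast
    then have "proper_colouring (f ` V) (rename_adj f E) k (g \<circ> inv f)"
      using assms by (auto simp: proper_colouring_def rename_adj_def)
    then show "\<exists>g. proper_colouring (f ` V) (rename_adj f E) k g" by blast
  qed
  then show ?thesis by (simp add: chromatic_number_def)
qed

section \<open>Counting boundary edges of a path\<close>

fun boundary_count :: "'a set \<Rightarrow> 'a list \<Rightarrow> nat" where
  "boundary_count A (x # y # r) = of_bool ((x \<in> A) \<noteq> (y \<in> A)) + boundary_count A (y # r)"
| "boundary_count A _ = 0"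

text \<open>Every crossing changes sides, so the number of crossings is odd exactly when the ends
  lie on different sides.\<close>

lemma even_boundary_count:
  "p \<noteq> [] \<Longrightarrow> even (boundary_count A p + of_bool (hd p \<in> A) + of_bool (last p \<in> A))"
  by (induction p rule: induct_list012) auto

text \<open>A path meets \<open>x\<close> only once, so the edge \<open>{x, y}\<close> does not lie
  inside the rest of the path; counting only edges within \<open>set p\<close> makes each crossing
  contribute a new one.\<close>

lemma boundary_count_le_card:
  assumes "distinct p" "successively E p" "finite F"
    and "\<And>x y. E x y \<Longrightarrow> x \<in> A \<longleftrightarrow> y \<notin> A \<Longrightarrow> {x, y} \<in> F"
  shows "boundary_count A p \<le> card {e \<in> F. e \<subseteq> set p}"
  using assms
proof (induction p rule: induct_list012)
  case (3 x y r)
  let ?S = "{e \<in> F. e \<subseteq> set (y # r)}" and ?T = "{e \<in> F. e \<subseteq> set (x # y # r)}"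
  have IH: "boundary_count A (y # r) \<le> card ?S" using 3 by simp
  have fin: "finite ?T" and sub: "?S \<subseteq> ?T" using \<open>finite F\<close> by auto
  show ?case
  proof (cases "(x \<in> A) = (y \<in> A)")
    case True
    then show ?thesis using IH card_mono[OF fin sub] by simp
  next
    case False
    then have "insert {x, y} ?S \<subseteq> ?T" using 3 by auto
    then have "card (insert {x, y} ?S) \<le> card ?T" using card_mono fin by blast
    moreover have "{x, y} \<notin> ?S" using \<open>distinct (x # y # r)\<close> by auto
    ultimately show ?thesis using IH False \<open>finite F\<close> by simp
  qed
qed auto

text \<open>\<open>b\<close> maps a vertex of a clique to the index of that clique, and linkers to \<open>None\<close>.\<close>

lemma linkers_on_path_le:
  fixes b :: "'a \<Rightarrow> 'k option"
  assumes path: "p \<noteq> []" "distinct p" "successively E p"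
    and K: "finite K" "\<And>v k. v \<in> set p \<Longrightarrow> b v = Some k \<Longrightarrow> k \<in> K"
    and sep: "\<And>x y. E x y \<Longrightarrow> b x \<noteq> b y \<Longrightarrow> b x = None \<or> b y = None"
    and indep: "\<And>x y. E x y \<Longrightarrow> b x \<noteq> None \<or> b y \<noteq> None"
    and F: "\<And>k. k \<in> K \<Longrightarrow> finite (F k) \<and> card (F k) \<le> 3"
    and bd: "\<And>k x y. k \<in> K \<Longrightarrow> E x y \<Longrightarrow> b x = Some k \<longleftrightarrow> b y \<noteq> Some k \<Longrightarrow> {x, y} \<in> F k"
  shows "card {v \<in> set p. b v = None} \<le> card K + 1"
proof -
  let ?A = "\<lambda>k. {v. b v = Some k}"
  \<comment> \<open>Each vertex on the path is a linker or in exactly one clique; applied to the two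
    ends, this yields the final \<open>+ 2\<close>.\<close>
  have delta: "(\<Sum>k\<in>K. of_bool (b v = Some k)) + of_bool (b v = None) = (1 :: nat)"
    if "v \<in> set p" for v
  proof (cases "b v")
    case (Some k)
    then have "k \<in> K" using K that by blast
    then show ?thesis using Some K(1) by (simp add: of_bool_def sum.delta)
  qed simp
  \<comment> \<open>There are at most 3 crossings, and by parity 3 is possible only if exactly one
    end lies in the clique.\<close>
  have block: "boundary_count (?A k) p
      \<le> 2 + (of_bool (b (hd p) = Some k) + of_bool (b (last p) = Some k))" if "k \<in> K" for k
  proof -
    have "boundary_count (?A k) p \<le> card {e \<in> F k. e \<subseteq> set p}"
      using path F[OF that] bd[OF that] by (intro boundary_count_le_card[of _ E]) auto
    also have "\<dots> \<le> card (F k)"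
      using F[OF that] by (intro card_mono) auto
    finally have "boundary_count (?A k) p \<le> 3" using F[OF that] by linarith
    moreover have "even (boundary_count (?A k) p
        + of_bool (b (hd p) = Some k) + of_bool (b (last p) = Some k))"
      using even_boundary_count[OF path(1), of "?A k"] by simp
    ultimately show ?thesis
      by presburger
  qed
  \<comment> \<open>An interior linker causes two crossings, since linkers are not adjacent to each
    other; the last two terms make up for the crossing missing at an end.\<close>
  have linkers: "2 * length (filter (\<lambda>v. b v = None) p)
      \<le> (\<Sum>k\<in>K. boundary_count (?A k) p) + of_bool (b (hd p) = None) + of_bool (b (last p) = None)"
    using path K(2)
  proof (induction p rule: induct_list012)
    case (3 x y r)
    have "distinct (y # r)" "successively E (y # r)"
      and "\<And>v k. v \<in> set (y # r) \<Longrightarrow> b v = Some k \<Longrightarrow> k \<in> K"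
      using 3 by auto
    then have IH: "2 * length (filter (\<lambda>v. b v = None) (y # r))
      \<le> (\<Sum>k\<in>K. boundary_count (?A k) (y # r))
          + of_bool (b y = None) + of_bool (b (last (y # r)) = None)"
      using "3.IH"(2) by (simp only: list.sel) blast
    have xy: "E x y" using 3 by simp
    have step: "of_bool (b x = None) + of_bool (b y = None)
        \<le> (\<Sum>k\<in>K. of_bool ((b x = Some k) \<noteq> (b y = Some k)) :: nat)"
    proof (cases "b x = b y")
      case True
      then show ?thesis using indep[OF xy] by simp
    next
      case False
      then obtain k where k: "b x = Some k \<and> b y = None \<or> b x = None \<and> b y = Some k"
        using sep[OF xy] by (cases "b x"; cases "b y") auto
      then have "k \<in> K" using 3 by auto
      then have "of_bool ((b x = Some k) \<noteq> (b y = Some k))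
          \<le> (\<Sum>k\<in>K. of_bool ((b x = Some k) \<noteq> (b y = Some k)) :: nat)"
        using K(1) by (intro member_le_sum) auto
      then show ?thesis using k by auto
    qed
    have "(\<Sum>k\<in>K. boundary_count (?A k) (x # y # r))
        = (\<Sum>k\<in>K. of_bool ((b x = Some k) \<noteq> (b y = Some k)))
          + (\<Sum>k\<in>K. boundary_count (?A k) (y # r))"
      by (simp add: sum.distrib)
    moreover have "length (filter (\<lambda>v. b v = None) (x # y # r))
        = of_bool (b x = None) + length (filter (\<lambda>v. b v = None) (y # r))"
      by simp
    ultimately have "2 * length (filter (\<lambda>v. b v = None) (x # y # r))
        \<le> (\<Sum>k\<in>K. boundary_count (?A k) (x # y # r))
          + of_bool (b x = None) + of_bool (b (last (y # r)) = None)"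
      using IH step by linarith
    then show ?case by (simp del: filter.simps boundary_count.simps)
  qed auto
  have ends: "hd p \<in> set p" "last p \<in> set p" using path(1) by auto
  have "(\<Sum>k\<in>K. boundary_count (?A k) p)
      \<le> (\<Sum>k\<in>K. 2 + (of_bool (b (hd p) = Some k) + of_bool (b (last p) = Some k)))"
    using block by (rule sum_mono)
  also have "\<dots> = 2 * card K + (\<Sum>k\<in>K. of_bool (b (hd p) = Some k))
      + (\<Sum>k\<in>K. of_bool (b (last p) = Some k))"
    by (simp only: sum.distrib sum_constant) simp
  finally have "2 * length (filter (\<lambda>v. b v = None) p) \<le> 2 * card K + 2"
    using linkers delta[OF ends(1)] delta[OF ends(2)] by linarith
  moreover have "length (filter (\<lambda>v. b v = None) p) = card {v \<in> set p. b v = None}"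
    using path(2) by (metis distinct_card distinct_filter set_filter)
  ultimately show ?thesis by linarith
qed

section \<open>The ring of cliques\<close>

text \<open>Clique \<open>k\<close> consists of the vertices \<open>Q k j\<close>; only \<open>j = 0, 1, 2\<close> have a neighbour outside.
  The linker \<open>R k\<close> joins clique \<open>k\<close> to the cyclically next one, and \<open>M i\<close> joins the cliques
  \<open>2 * i\<close> and \<open>2 * i + 1\<close>.\<close>

datatype vertex = Q nat nat | R nat | M nat

instance vertex :: countable
  by countable_datatype

locale clique_ring =
  fixes c n :: nat
  assumes c: "c \<ge> 3" and n: "n \<ge> 1"
begin

abbreviation m :: nat where "m \<equiv> 2 * n"

definition clique :: "nat \<Rightarrow> vertex set" where
  "clique k = Q k ` {..<c}"

definition verts :: "vertex set" where
  "verts = (\<Union>k<m. clique k) \<union> R ` {..<m} \<union> M ` {..<n}"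

lemma mem_verts [simp]:
  "Q k j \<in> verts \<longleftrightarrow> k < m \<and> j < c" "R i \<in> verts \<longleftrightarrow> i < m" "M i \<in> verts \<longleftrightarrow> i < n"
  by (auto simp: verts_def clique_def)

text \<open>Edges at linkers are oriented from clique to linker, which halves the case analyses;
  \<open>adj\<close> symmetrises. In each clique, 0 is the ring entrance, 1 the ring exit and 2 the
  chord end; \<open>mod m\<close> closes the ring.\<close>

fun arc :: "vertex \<Rightarrow> vertex \<Rightarrow> bool" where
  "arc (Q k i) (Q l j) \<longleftrightarrow> k = l \<and> k < m \<and> i < c \<and> j < c \<and> i \<noteq> j"
| "arc (Q k j) (R i) \<longleftrightarrow> i < m \<and> (j = 1 \<and> k = i \<or> j = 0 \<and> k = Suc i mod m)"
| "arc (Q k j) (M i) \<longleftrightarrow> k < m \<and> j = 2 \<and> i = k div 2"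
| "arc _ _ \<longleftrightarrow> False"

definition adj :: "vertex \<Rightarrow> vertex \<Rightarrow> bool" where
  "adj u v \<longleftrightarrow> arc u v \<or> arc v u"

lemma adj_sym: "adj u v \<Longrightarrow> adj v u"
  by (auto simp: adj_def)

lemma arc_verts: "arc u v \<Longrightarrow> u \<in> verts \<and> v \<in> verts"
  using c n by (induction u v rule: arc.induct) auto

lemma simple_graph: "simple_graph verts adj"
proof -
  have "\<not> arc v v" for v by (cases v) auto
  then show ?thesis
    using arc_verts by (auto simp: simple_graph_def adj_def verts_def clique_def)
qed

lemma finite_verts: "finite verts"
  using simple_graph by (simp add: simple_graph_def)

text \<open>\<open>Q k j\<close> gets colour \<open>j\<close>. Ring linkers see only colours 0 and
  1, chord linkers only 2, so three colours suffice for all linkers; clique 0 forces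
  \<open>c\<close> colours.\<close>

lemma chromatic_number: "chromatic_number verts adj = c"
  unfolding chromatic_number_def
proof (rule Least_equality)
  let ?f = "\<lambda>v. case v of Q k j \<Rightarrow> j | R i \<Rightarrow> 2 | M i \<Rightarrow> 0"
  have "arc u v \<Longrightarrow> ?f u \<noteq> ?f v" for u v
    by (induction u v rule: arc.induct) auto
  then have "proper_colouring verts adj c ?f"
    using c by (fastforce simp: proper_colouring_def adj_def verts_def clique_def)
  then show "\<exists>f. proper_colouring verts adj c f" by blast
next
  fix k assume "\<exists>f. proper_colouring verts adj k f"
  then obtain f where f: "proper_colouring verts adj k f" by blast
  have "inj_on f (clique 0)"
  proof (rule inj_onI, rule ccontr)
    fix u v assume "u \<in> clique 0" "v \<in> clique 0" "f u = f v" "u \<noteq> v"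
    moreover from this have "adj u v" using n by (auto simp: clique_def adj_def)
    ultimately show False using f by (auto simp: proper_colouring_def)
  qed
  moreover have "f ` clique 0 \<subseteq> {..<k}"
    using f n by (auto simp: proper_colouring_def clique_def)
  ultimately have "card (clique 0) \<le> k"
    using card_inj_on_le[of f "clique 0" "{..<k}"] by simp
  then show "c \<le> k" by (simp add: clique_def card_image inj_on_def)
qed

section \<open>Upper bound on the order of a path\<close>

fun block :: "vertex \<Rightarrow> nat option" where
  "block (Q k j) = Some k"
| "block _ = None"

definition prev :: "nat \<Rightarrow> nat" where
  "prev k = (if k = 0 then m - 1 else k - 1)"

lemma prev_Suc_mod [simp]: "i < m \<Longrightarrow> prev (Suc i mod m) = i"
  by (cases "Suc i = m") (auto simp: prev_def)

definition clique_boundary :: "nat \<Rightarrow> vertex set set" where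
  "clique_boundary k =
    {{Q k 0, R (prev k)}, {Q k 1, R k}, {Q k 2, M (k div 2)}}"

lemma arc_boundary:
  assumes "arc x y" "block x \<noteq> block y"
  obtains k where "block x = Some k" "block y = None" "{x, y} \<in> clique_boundary k"
proof -
  have "\<exists>k. block x = Some k \<and> block y = None \<and> {x, y} \<in> clique_boundary k"
    using assms by (induction x y rule: arc.induct) (auto simp: clique_boundary_def)
  then show thesis using that by blast
qed

lemma adj_boundary:
  assumes "adj x y" "block x = Some k \<longleftrightarrow> block y \<noteq> Some k"
  shows "{x, y} \<in> clique_boundary k"
  using assms(1) unfolding adj_def
proof
  assume "arc x y"
  then show ?thesis using assms(2) by (elim arc_boundary) auto
next
  assume "arc y x"
  then show ?thesis using assms(2) by (elim arc_boundary) (auto simp: insert_commute)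
qed

lemma adj_block: "adj x y \<Longrightarrow> block x \<noteq> None \<or> block y \<noteq> None"
  unfolding adj_def by (cases x; cases y) auto

text \<open>There are \<open>m + n = 3 * n\<close> linkers, and a path contains at most
  \<open>m + 1\<close> of them.\<close>

lemma path_misses:
  assumes "is_path verts adj p"
  shows "length p + (n - 1) \<le> card verts"
proof -
  have "card (clique_boundary k) \<le> 3" for k
    unfolding clique_boundary_def by (rule card_insert_le_m1 | simp)+
  moreover have "finite (clique_boundary k)" for k
    by (simp add: clique_boundary_def)
  ultimately have "card {v \<in> set p. block v = None} \<le> card {..<m} + 1"
  proof (intro linkers_on_path_le[where E = adj and F = clique_boundary])
    fix x y assume "adj x y" "block x \<noteq> block y"
    then show "block x = None \<or> block y = None"
      unfolding adj_def by (metis arc_boundary)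
  next
    fix k x y assume "adj x y" "(block x = Some k) = (block y \<noteq> Some k)"
    then show "{x, y} \<in> clique_boundary k"
      by (rule adj_boundary)
  next
    fix v k assume "v \<in> set p" "block v = Some k"
    then show "k \<in> {..<m}"
      using assms by (cases v) (auto simp: is_path_iff_successively verts_def clique_def)
  qed (use assms adj_block in \<open>auto simp: is_path_iff_successively\<close>)
  then have on: "card {v \<in> set p. block v = None} \<le> m + 1" by simp
  let ?L = "{v \<in> verts. block v = None}"
  have L: "?L = R ` {..<m} \<union> M ` {..<n}"
    by (auto simp: verts_def clique_def)
  have "card ?L = m + n"
    by (subst L, subst card_Un_disjoint) (auto simp: card_image inj_on_def)
  moreover have "card ?L - card {v \<in> set p. block v = None}
      \<le> card (?L - {v \<in> set p. block v = None})"
    by (rule diff_card_le_card_Diff) simp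
  moreover have "card (?L - {v \<in> set p. block v = None}) \<le> card (verts - set p)"
    using finite_verts by (intro card_mono) auto
  moreover have "card (verts - set p) = card verts - length p" "length p \<le> card verts"
    using assms finite_verts
    by (auto simp: is_path_length_card is_path_iff_successively card_Diff_subset card_mono)
  ultimately show ?thesis using on by linarith
qed

section \<open>Paths around the ring\<close>

text \<open>Any ordering of clique vertices is a path. A general \<open>J\<close> is allowed because
  a path may visit one clique in two pieces.\<close>

lemma ex_clique_path:
  assumes "k < m" "J \<subseteq> {..<c}" "i \<in> J" "j \<in> J" "i \<noteq> j"
  shows "\<exists>p. is_path verts adj p \<and> set p = Q k ` J \<and> hd p = Q k i \<and> last p = Q k j"
proof -
  have "finite J" using assms(2) finite_subset by blast
  then obtain xs where xs: "set xs = J - {i, j}" "distinct xs"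
    by (meson finite_Diff finite_distinct_list)
  let ?p = "map (Q k) (i # xs @ [j])"
  have ys: "distinct (i # xs @ [j])" "set (i # xs @ [j]) = J" using xs assms by auto
  have "successively adj (map (Q k) zs)" if "distinct zs" "set zs \<subseteq> {..<c}" for zs
    using that \<open>k < m\<close> by (induction zs rule: induct_list012) (auto simp: adj_def)
  from this[OF ys(1)] have "is_path verts adj ?p"
    using ys assms by (auto simp: is_path_iff_successively distinct_map inj_on_def)
  moreover have "set ?p = Q k ` J" using ys(2) by (metis set_map)
  ultimately show ?thesis by (intro exI[of _ ?p]) simp
qed

text \<open>Starts at the linker leaving clique \<open>k\<close> and crosses the next
  \<open>t\<close> cliques, using \<open>X i\<close> inside clique \<open>i\<close>.\<close>

primrec ring_walk :: "(nat \<Rightarrow> vertex list) \<Rightarrow> nat \<Rightarrow> nat \<Rightarrow> vertex list" where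
  "ring_walk X k 0 = [R (k mod m)]"
| "ring_walk X k (Suc t) = ring_walk X k t @ X ((k + Suc t) mod m) @ [R ((k + Suc t) mod m)]"

text \<open>Only inclusion in the clique is demanded, so that a crossing can spare a vertex visited
  elsewhere.\<close>

definition crossing :: "nat \<Rightarrow> vertex list \<Rightarrow> bool" where
  "crossing k p \<longleftrightarrow> is_path verts adj p \<and> set p \<subseteq> clique k \<and> hd p = Q k 0 \<and> last p = Q k 1"

lemma inj_on_shift: "inj_on (\<lambda>s. (k + s) mod m) {..<m}"
proof (rule linorder_inj_onI)
  fix s t assume "s < t" "s \<in> {..<m}" "t \<in> {..<m}"
  then show "(k + s) mod m \<noteq> (k + t) mod m"
    using n by (metis add_diff_cancel_left dvd_imp_le lessThan_iff less_imp_diff_less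
        mod_eq_dvd_iff_nat nat_add_left_cancel_le less_imp_le not_le zero_less_diff)
qed auto

text \<open>For \<open>t < m\<close> the indices visited are distinct by
  \<open>inj_on_shift\<close>, so each added crossing and linker is new.\<close>

lemma ring_walk:
  assumes "\<And>i. i < m \<Longrightarrow> crossing i (X i)" "t < m"
  shows "is_path verts adj (ring_walk X k t) \<and> hd (ring_walk X k t) = R (k mod m)
    \<and> last (ring_walk X k t) = R ((k + t) mod m)
    \<and> set (ring_walk X k t) = (\<lambda>s. R ((k + s) mod m)) ` {..t}
        \<union> (\<Union>s\<in>{1..t}. set (X ((k + s) mod m)))"
  using assms(2)
proof (induction t)
  case 0
  then show ?case by (simp add: is_path_iff_successively)
next
  case (Suc t)
  define i where "i = (k + Suc t) mod m"
  have i: "i < m" "Suc ((k + t) mod m) mod m = i"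
    using Suc.prems by (simp_all add: i_def mod_Suc_eq)
  have new: "(k + s) mod m \<noteq> i" if "s \<le> t" for s
    using that Suc.prems inj_onD[OF inj_on_shift, of k s "Suc t"] by (auto simp: i_def)
  have X: "set (X ((k + s) mod m)) \<subseteq> clique ((k + s) mod m)" for s
    using assms(1) Suc.prems by (simp add: crossing_def)
  have IH: "is_path verts adj (ring_walk X k t)" "hd (ring_walk X k t) = R (k mod m)"
    "last (ring_walk X k t) = R ((k + t) mod m)"
    and set_IH: "set (ring_walk X k t) = (\<lambda>s. R ((k + s) mod m)) ` {..t}
        \<union> (\<Union>s\<in>{1..t}. set (X ((k + s) mod m)))"
    using Suc by auto
  have Xi: "is_path verts adj (X i)" "set (X i) \<subseteq> clique i" "hd (X i) = Q i 0" "last (X i) = Q i 1"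
    using assms(1)[OF i(1)] by (auto simp: crossing_def)
  have "R i \<notin> set (ring_walk X k t)"
    unfolding set_IH using new X by (fastforce simp: clique_def)
  moreover have "set (X i) \<inter> set (ring_walk X k t) = {}"
  proof -
    have "clique i \<inter> clique ((k + s) mod m) = {}" if "s \<le> t" for s
      using new[OF that] by (auto simp: clique_def)
    then show ?thesis
      unfolding set_IH using X Xi(2) by (fastforce simp: clique_def)
  qed
  moreover have "R i \<notin> set (X i)" using Xi(2) by (auto simp: clique_def)
  moreover have "adj (R ((k + t) mod m)) (Q i 0)" "adj (Q i 1) (R i)"
    using i Suc.prems by (auto simp: adj_def)
  ultimately have "is_path verts adj (ring_walk X k t @ X i @ [R i])"
    using IH Xi i(1)
    by (auto simp: is_path_iff_successively successively_append_iff)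
  moreover have "hd (ring_walk X k t @ X i @ [R i]) = R (k mod m)"
    using IH by (simp add: is_path_iff_successively)
  moreover have "ring_walk X k (Suc t) = ring_walk X k t @ X i @ [R i]"
    by (simp add: i_def)
  ultimately show ?case
    using set_IH by (auto simp: i_def atMost_Suc atLeastAtMostSuc_conv)
qed

text \<open>After \<open>m - 1\<close> crossings all ring linkers are used and only clique
  \<open>k\<close> is omitted, free for use before the start or after the end.\<close>

lemma ex_ring_path:
  assumes "\<And>i. i < m \<Longrightarrow> crossing i (X i)" "k < m"
  shows "\<exists>p. is_path verts adj p \<and> hd p = R k \<and> last p = R (prev k)
    \<and> set p = R ` {..<m} \<union> (\<Union>i\<in>{..<m} - {k}. set (X i))"
proof -
  let ?f = "\<lambda>s. (k + s) mod m" and ?p = "ring_walk X k (m - 1)"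
  have img: "?f ` {..<m} = {..<m}"
    using n by (intro card_subset_eq) (auto simp: card_image inj_on_shift)
  have "?f ` ({..<m} - {0}) = ?f ` {..<m} - ?f ` {0}"
    using n by (intro inj_on_image_set_diff[OF inj_on_shift]) auto
  then have img': "?f ` ({..<m} - {0}) = {..<m} - {k}"
    using img \<open>k < m\<close> by simp
  have "{..m - 1} = {..<m}" "{1..m - 1} = {..<m} - {0}"
    using n by auto
  then have "(\<lambda>s. R (?f s)) ` {..m - 1} = R ` {..<m}"
    "(\<Union>s\<in>{1..m - 1}. set (X (?f s))) = (\<Union>i\<in>{..<m} - {k}. set (X i))"
    using img img' by (metis image_image)+
  moreover have "(k + (m - 1)) mod m = prev k"
    using \<open>k < m\<close> by (auto simp: prev_def mod_if)
  moreover have "m - 1 < m" using n by simp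
  ultimately show ?thesis
    using ring_walk[OF assms(1), of "m - 1" k] \<open>k < m\<close>
    by (intro exI[of _ ?p]) (simp only: mod_less simp_thms)
qed

section \<open>Longest paths from every vertex\<close>

lemma verts_minus_subset:
  assumes "R ` {..<m} \<subseteq> S" "\<And>i. i < m \<Longrightarrow> clique i \<subseteq> S" "M i \<in> S"
  shows "verts - S \<subseteq> M ` ({..<n} - {i})"
  using assms by (auto simp: verts_def)

lemma adj_ring:
  "k < m \<Longrightarrow> adj (Q k 1) (R k)" "k < m \<Longrightarrow> adj (R k) (Q k 1)"
  "k < m \<Longrightarrow> adj (R (prev k)) (Q k 0)" "k < m \<Longrightarrow> adj (Q k 0) (R (prev k))"
  "k < m \<Longrightarrow> adj (Q k 2) (M (k div 2))" "k < m \<Longrightarrow> adj (M (k div 2)) (Q k 2)"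
  using n by (auto simp: adj_def prev_def)

text \<open>Each path combines a full turn around the ring with the omitted clique and one chord
  linker, so that only the other \<open>n - 1\<close> chord linkers can be missed.\<close>

lemma long_path_from:
  assumes "v \<in> verts"
  shows "\<exists>p i. is_path verts adj p \<and> (hd p = v \<or> last p = v) \<and> i < n
    \<and> verts - set p \<subseteq> M ` ({..<n} - {i})"
proof -
  have "\<exists>p. crossing i p \<and> set p = clique i" if "i < m" for i
    using ex_clique_path[OF that order_refl, of 0 1] c
    by (auto simp: crossing_def clique_def)
  then obtain X where X: "\<And>i. i < m \<Longrightarrow> crossing i (X i)" "\<And>i. i < m \<Longrightarrow> set (X i) = clique i"
    by metis
  have ring: "\<exists>W. is_path verts adj W \<and> hd W = R k \<and> last W = R (prev k)
      \<and> set W = R ` {..<m} \<union> (\<Union>i\<in>{..<m} - {k}. clique i)" if "k < m" for k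
    using ex_ring_path[OF X(1) that] X(2) by simp
  \<comment> \<open>One path serves both kinds of linkers: its ends are a ring linker and a chord
    linker.\<close>
  have linker: "\<exists>p. is_path verts adj p \<and> hd p = R k \<and> last p = M (k div 2)
      \<and> verts - set p \<subseteq> M ` ({..<n} - {k div 2})" if k: "k < m" for k
  proof -
    obtain W where W: "is_path verts adj W" "hd W = R k" "last W = R (prev k)"
      "set W = R ` {..<m} \<union> (\<Union>i\<in>{..<m} - {k}. clique i)" using ring[OF k] by blast
    obtain T where T: "is_path verts adj T" "set T = clique k" "hd T = Q k 0" "last T = Q k 2"
      using ex_clique_path[OF k order_refl, of 0 2] c by (auto simp: clique_def)
    let ?p = "W @ T @ [M (k div 2)]"
    have "is_path verts adj ?p"
      using W T adj_ring[OF k] k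
      by (auto simp: is_path_iff_successively successively_append_iff clique_def)
    moreover have "verts - set ?p \<subseteq> M ` ({..<n} - {k div 2})"
      using W(4) T(2) by (intro verts_minus_subset) auto
    moreover have "hd ?p = R k" "last ?p = M (k div 2)"
      using W by (simp_all add: is_path_iff_successively)
    ultimately show ?thesis by blast
  qed
  show ?thesis
  proof (cases v)
    case (R k)
    then have "k < m" "k div 2 < n" using assms by auto
    then show ?thesis using linker[of k] R by blast
  next
    case (M i)
    then have "2 * i < m" "2 * i div 2 = i" "i < n" using assms by auto
    then show ?thesis using linker[of "2 * i"] M by metis
  next
    case (Q k j)
    then have k: "k < m" "k div 2 < n" and j: "j < c" using assms by auto
    obtain W where W: "is_path verts adj W" "hd W = R k" "last W = R (prev k)"
      "set W = R ` {..<m} \<union> (\<Union>i\<in>{..<m} - {k}. clique i)" using ring[OF k(1)] by blast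
    consider "j = 0" | "j = 2" | "j \<noteq> 0" "j \<noteq> 2" by blast
    then show ?thesis
    proof cases
      case 1
      obtain T where T: "is_path verts adj T" "set T = Q k ` ({..<c} - {0})"
        "hd T = Q k 1" "last T = Q k 2"
        using ex_clique_path[OF k(1), of "{..<c} - {0}" 1 2] c by auto
      \<comment> \<open>The turn is made backwards, from \<open>R (prev k)\<close> to
        \<open>R k\<close>, and returns to clique \<open>k\<close> at vertex 1.\<close>
      let ?p = "Q k 0 # rev W @ T @ [M (k div 2)]"
      have "is_path verts adj (rev W)" using W(1) adj_sym by (rule is_path_rev)
      then have "is_path verts adj ?p"
        using W T adj_ring[OF k(1)] k c
        by (auto simp: is_path_iff_successively successively_append_iff successively_Cons
            hd_append hd_rev last_rev clique_def)
      moreover have "verts - set ?p \<subseteq> M ` ({..<n} - {k div 2})"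
        using W(4) T(2) by (intro verts_minus_subset) (auto simp: clique_def)
      ultimately show ?thesis using k Q 1 by (intro exI[of _ ?p] exI[of _ "k div 2"]) simp
    next
      case 2
      txt \<open>Leave along the chord and go around the ring; clique \<open>k\<close> is then crossed avoiding \<open>v\<close>.\<close>
      define l where "l = (if even k then k + 1 else k - 1)"
      have l: "l < m" "l div 2 = k div 2" "l \<noteq> k"
        using k by (auto simp: l_def elim!: evenE oddE)
      obtain Y where Y: "is_path verts adj Y" "set Y = Q k ` ({..<c} - {2})"
        "hd Y = Q k 0" "last Y = Q k 1"
        using ex_clique_path[OF k(1), of "{..<c} - {2}" 0 1] c by auto
      have "crossing i ((X(k := Y)) i)" if "i < m" for i
        using X(1)[OF that] Y by (auto simp: crossing_def clique_def)
      from ex_ring_path[OF this l(1)] obtain W where W: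
        "is_path verts adj W" "hd W = R l"
        "set W = R ` {..<m} \<union> (\<Union>i\<in>{..<m} - {l}. set ((X(k := Y)) i))" by blast
      have crossed: "(\<Union>i\<in>{..<m} - {l}. set ((X(k := Y)) i))
          = (\<Union>i\<in>{..<m} - {l, k}. clique i) \<union> Q k ` ({..<c} - {2})"
        (is "?U = _")
      proof -
        have "{..<m} - {l} = insert k ({..<m} - {l, k})" using k l by auto
        then have "?U = set Y \<union> (\<Union>i\<in>{..<m} - {l, k}. set ((X(k := Y)) i))" by simp
        also have "(\<Union>i\<in>{..<m} - {l, k}. set ((X(k := Y)) i))
            = (\<Union>i\<in>{..<m} - {l, k}. clique i)"
          using X(2) by (intro SUP_cong) auto
        finally show ?thesis using Y(2) by blast
      qed
      have setW: "set W = R ` {..<m} \<union> (\<Union>i\<in>{..<m} - {l, k}. clique i)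
          \<union> Q k ` ({..<c} - {2})"
        using W(3) unfolding crossed by (simp only: Un_assoc)
      obtain T where T: "is_path verts adj T" "set T = clique l" "hd T = Q l 2" "last T = Q l 1"
        using ex_clique_path[OF l(1) order_refl, of 2 1] c by (auto simp: clique_def)
      \<comment> \<open>The turn \<open>W\<close> omits clique \<open>l\<close>, the partner of
        \<open>k\<close> on the chord; \<open>T\<close> sweeps that clique from its chord end to its
        exit, where \<open>W\<close> starts.\<close>
      let ?p = "Q k 2 # M (k div 2) # T @ W"
      have "set T \<inter> set W = {}" "Q k 2 \<notin> set T \<union> set W" "M (k div 2) \<notin> set T \<union> set W"
        unfolding setW T(2) using l(3) by (auto simp: clique_def)
      then have "is_path verts adj ?p"
        using W(1,2) T adj_ring[OF k(1)] adj_ring[OF l(1)] k l c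
        by (auto simp: is_path_iff_successively successively_append_iff successively_Cons
            hd_append)
      moreover have "verts - set ?p \<subseteq> M ` ({..<n} - {k div 2})"
      proof (rule verts_minus_subset)
        fix i assume "i < m"
        then show "clique i \<subseteq> set ?p"
          using setW T(2) by (cases "i = k"; cases "i = l") (auto simp: clique_def)
      qed (use setW in auto)
      ultimately show ?thesis using k Q 2 by (intro exI[of _ ?p] exI[of _ "k div 2"]) simp
    next
      case 3
      obtain T where T: "is_path verts adj T" "set T = Q k ` ({..<c} - {j, 1})"
        "hd T = Q k 0" "last T = Q k 2"
        using ex_clique_path[OF k(1), of "{..<c} - {j, 1}" 0 2] c 3 by auto
      \<comment> \<open>The start uses only \<open>j\<close> and the exit 1 of clique
        \<open>k\<close>; its other vertices are swept by \<open>T\<close> after the turn. For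
        \<open>j = 1\<close> the two coincide.\<close>
      define S where "S = (if j = 1 then [Q k 1] else [Q k j, Q k 1])"
      have S: "is_path verts adj S" "set S = Q k ` {j, 1}" "hd S = Q k j" "last S = Q k 1"
        using k j c by (auto simp: S_def is_path_iff_successively adj_def)
      let ?p = "S @ W @ T @ [M (k div 2)]"
      have "is_path verts adj ?p"
        using W T S adj_ring[OF k(1)] k c
        by (auto simp: is_path_iff_successively successively_append_iff clique_def)
      moreover have "verts - set ?p \<subseteq> M ` ({..<n} - {k div 2})"
        using W(4) T(2) S(2) by (intro verts_minus_subset) (auto simp: clique_def)
      moreover have "hd ?p = v" using S Q by (simp add: is_path_iff_successively)
      ultimately show ?thesis using k by blast
    qed
  qed
qed

text \<open>The construction misses at most \<open>n - 1\<close> vertices and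
  \<open>path_misses\<close> gives the converse; reversal puts \<open>v\<close> in front.\<close>

lemma ex_longest_path_from:
  assumes "v \<in> verts"
  shows "\<exists>p. is_path verts adj p \<and> hd p = v \<and> length p + (n - 1) = card verts"
proof -
  obtain p i where p: "is_path verts adj p" "hd p = v \<or> last p = v" "i < n"
    "verts - set p \<subseteq> M ` ({..<n} - {i})"
    using long_path_from[OF assms] by blast
  have "card (verts - set p) \<le> card (M ` ({..<n} - {i}))"
    using p(4) by (intro card_mono) auto
  also have "\<dots> \<le> card ({..<n} - {i})" by (rule card_image_le) simp
  also have "\<dots> = n - 1" using p(3) by simp
  finally have "card (verts - set p) \<le> n - 1" .
  moreover have "card (verts - set p) = card verts - length p"
    using p(1) finite_verts
    by (auto simp: is_path_length_card is_path_iff_successively card_Diff_subset)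
  ultimately have len: "length p + (n - 1) = card verts"
    using path_misses[OF p(1)] by linarith
  show ?thesis
  proof (cases "hd p = v")
    case False
    then have "hd (rev p) = v" using p by (simp add: is_path_iff_successively hd_rev)
    then show ?thesis using is_path_rev[OF p(1) adj_sym] len by fastforce
  qed (use p len in blast)
qed

text \<open>With \<open>n = d + 1\<close> this gives \<open>2 * d < card verts\<close>: subtracting
  \<open>d\<close> does not truncate, and more than half of the vertices remain.\<close>

lemma card_verts_ge: "m \<le> card verts"
proof -
  have "card (R ` {..<m}) \<le> card verts"
    using finite_verts by (intro card_mono) auto
  then show ?thesis by (simp add: card_image inj_on_def)
qed

end

section \<open>Transfer to natural numbers and conclusion\<close>

theorem theorem2p26:
  fixes c d :: nat
  assumes "c \<ge> 3" and "d \<ge> 1"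
  shows "\<exists>(V :: nat set) E. simple_graph V E \<and> V \<noteq> {} \<and> graph_connected V E
           \<and> \<not> traceable V E \<and> detour_graph V E
           \<and> chromatic_number V E = c \<and> detour_deficiency V E = d"
proof -
  interpret clique_ring c "d + 1" using assms by unfold_locales auto
  let ?f = "to_nat :: vertex \<Rightarrow> nat"
  define V where "V = ?f ` verts"
  define E where "E = rename_adj ?f adj"
  \<comment> \<open>The common value of all \<open>tau_v\<close>, attained from every
    vertex.\<close>
  define l where "l = card verts - d"
  have inj: "inj ?f" by simp
  have card: "card V = card verts"
    unfolding V_def by (rule card_image) (rule inj_on_subset[OF inj], simp)
  have large: "2 * (d + 1) \<le> card V" using card_verts_ge card by simp
  have simple: "simple_graph V E"
    unfolding V_def E_def using inj simple_graph by (rule simple_graph_rename)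
  have upper: "length p \<le> l" if path: "is_path V E p" for p
  proof -
    obtain q where "is_path verts adj q" "p = map ?f q"
      using is_path_renameE[OF inj path[unfolded V_def E_def]] by blast
    then show ?thesis using path_misses[of q] by (simp add: l_def)
  qed
  have from_v: "\<exists>p. is_path V E p \<and> hd p = v \<and> length p = l" if v: "v \<in> V" for v
  proof -
    obtain u where u: "u \<in> verts" "v = ?f u" using v by (auto simp: V_def)
    obtain q where q: "is_path verts adj q" "hd q = u" "length q + d = card verts"
      using ex_longest_path_from[OF u(1)] by auto
    then have "is_path V E (map ?f q)"
      using is_path_rename_map[OF inj] by (simp add: V_def E_def)
    moreover have "hd (map ?f q) = v" "length (map ?f q) = l"
      using q u by (auto simp: is_path_def hd_map l_def)
    ultimately show ?thesis by blast
  qed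
  have "V \<noteq> {}" using large by auto
  then obtain p where "is_path V E p" "length p = l" using from_v by blast
  then have "tau V E = l" using upper by (intro tau_eqI)
  then have "detour_deficiency V E = d"
    using large card by (simp add: detour_deficiency_def l_def)
  moreover have "detour_graph V E"
    unfolding detour_graph_def using tau_v_eqI[OF upper] from_v by metis
  moreover have "\<not> traceable V E"
  proof
    assume "traceable V E"
    then obtain p where "is_path V E p" "set p = V" by (auto simp: traceable_def)
    then have "card V \<le> l" using upper is_path_length_card by metis
    then show False using large card assms(2) by (simp add: l_def)
  qed
  moreover have "graph_connected V E"
  proof (rule connected_if_long_paths[OF simple])
    show "card V < 2 * l" using large card by (simp add: l_def)
  qed (use from_v in blast)
  moreover have "chromatic_number V E = c"
    unfolding V_def E_def by (simp only: chromatic_number_rename[OF inj] chromatic_number)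
  ultimately show ?thesis using simple \<open>V \<noteq> {}\<close> by blast
qed

end
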